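(* Let $\mathbf{k}$ be a commutative unital ring, $\lambda\in\mathbf{k}$, let $A$ be a unital associative $\mathbf{k}$-algebra, and let $r=\sum_i u_i\otimes v_i\in A\otimes A$ be a solution of the associative Yang-Baxter equation of weight $\lambda$ in $A$. Then the linear operator $$P_r:A\to A,\qquad P_r(a)=\sum_i u_i a v_i$$ is a Rota-Baxter operator of weight $-\lambda$ on $A$.
   Context: Tensor products are over $\mathbf{k}$. For $r=\sum_i u_i\otimes v_i\in A\otimes A$, set $r_{12}=\sum_i u_i\otimes v_i\otimes 1$, $r_{13}=\sum_i u_i\otimes 1\otimes v_i$, $r_{23}=\sum_i 1\otimes u_i\otimes v_i$ in the tensor product algebra $A\otimes A\otimes A$. The element $r$ is a solution of the associative Yang-Baxter equation of weight $\lambda$ in $A$ if $r_{13}r_{12}-r_{12}r_{23}+r_{23}r_{13}=\lambda r_{13}$. A Rota-Baxter operator of weight $\mu\in\mathbf{k}$ on $A$ is a $\mathbf{k}$-linear map $P:A\to A$ with $P(a)P(b)=P(aP(b))+P(P(a)b)+\mu P(ab)$ for all $a,b\in A$. *)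

theory Defs
  imports "HOL-Algebra.Algebra" "HOL-Library.Poly_Mapping"
begin

(* The library locale "algebra" requires A to be commutative; here only the
   ring of scalars K is. *)
locale assoc_algebra = module K A + ring A for K (structure) and A (structure) +
  assumes smult_mult_left:
      "\<lbrakk>c \<in> carrier K; x \<in> carrier A; y \<in> carrier A\<rbrakk>
        \<Longrightarrow> (c \<odot>\<^bsub>A\<^esub> x) \<otimes>\<^bsub>A\<^esub> y = c \<odot>\<^bsub>A\<^esub> (x \<otimes>\<^bsub>A\<^esub> y)"
    and smult_mult_right:
      "\<lbrakk>c \<in> carrier K; x \<in> carrier A; y \<in> carrier A\<rbrakk>
        \<Longrightarrow> x \<otimes>\<^bsub>A\<^esub> (c \<odot>\<^bsub>A\<^esub> y) = c \<odot>\<^bsub>A\<^esub> (x \<otimes>\<^bsub>A\<^esub> y)"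

(* The integral monoid ring Z[G]: the free abelian group on G, with the product
   of G extended biadditively. *)
definition monoid_ring :: "('g, 'm) monoid_scheme \<Rightarrow> ('g \<Rightarrow>\<^sub>0 int) ring"
  where "monoid_ring G =
    \<lparr>carrier = {f. Poly_Mapping.keys f \<subseteq> carrier G},
     monoid.mult = (\<lambda>f g. frag_extend (\<lambda>x. frag_extend (\<lambda>y. frag_of (x \<otimes>\<^bsub>G\<^esub> y)) g) f),
     one = frag_of \<one>\<^bsub>G\<^esub>,
     ring.zero = 0,
     ring.add = (+)\<rparr>"

(* The additive group of A \<otimes> B over K is the quotient of the free abelian group on
   carrier A \<times> carrier B by the subgroup generated by the relators that make
   (x, y) \<mapsto> x \<otimes> y biadditive and K-balanced. *)
definition tensor_relators ::
    "('k, 'r) ring_scheme \<Rightarrow> ('k, 'a, 'm) module_scheme \<Rightarrow> ('k, 'b, 'n) module_scheme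
      \<Rightarrow> ('a \<times> 'b \<Rightarrow>\<^sub>0 int) set"
  where "tensor_relators K A B =
    {frag_of (x \<oplus>\<^bsub>A\<^esub> x', y) - frag_of (x, y) - frag_of (x', y) | x x' y.
        x \<in> carrier A \<and> x' \<in> carrier A \<and> y \<in> carrier B} \<union>
    {frag_of (x, y \<oplus>\<^bsub>B\<^esub> y') - frag_of (x, y) - frag_of (x, y') | x y y'.
        x \<in> carrier A \<and> y \<in> carrier B \<and> y' \<in> carrier B} \<union>
    {frag_of (c \<odot>\<^bsub>A\<^esub> x, y) - frag_of (x, c \<odot>\<^bsub>B\<^esub> y) | c x y.
        c \<in> carrier K \<and> x \<in> carrier A \<and> y \<in> carrier B}"

definition tensor_ideal ::
    "('k, 'r) ring_scheme \<Rightarrow> ('k, 'a, 'm) module_scheme \<Rightarrow> ('k, 'b, 'n) module_scheme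
      \<Rightarrow> ('a \<times> 'b \<Rightarrow>\<^sub>0 int) set"
  where "tensor_ideal K A B =
    generate (add_monoid (monoid_ring (A \<times>\<times> B))) (tensor_relators K A B)"

definition pure_tensor ::
    "('k, 'r) ring_scheme \<Rightarrow> ('k, 'a, 'm) module_scheme \<Rightarrow> ('k, 'b, 'n) module_scheme
      \<Rightarrow> 'a \<Rightarrow> 'b \<Rightarrow> ('a \<times> 'b \<Rightarrow>\<^sub>0 int) set"
  where "pure_tensor K A B x y =
    tensor_ideal K A B +>\<^bsub>monoid_ring (A \<times>\<times> B)\<^esub> frag_of (x, y)"

(* The subgroup above is a two-sided ideal of Z[A \<times> B], so the quotient is a ring, with
   (x \<otimes> y) (x' \<otimes> y') = x x' \<otimes> y y'.  The scalar c acts as multiplication by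
   c 1 \<otimes> 1, that is, c (x \<otimes> y) = c x \<otimes> y. *)
definition tensor_algebra ::
    "('k, 'r) ring_scheme \<Rightarrow> ('k, 'a, 'm) module_scheme \<Rightarrow> ('k, 'b, 'n) module_scheme
      \<Rightarrow> ('k, ('a \<times> 'b \<Rightarrow>\<^sub>0 int) set) module"
  where "tensor_algebra K A B =
    (let Q = monoid_ring (A \<times>\<times> B) Quot tensor_ideal K A B in
      \<lparr>carrier = carrier Q, monoid.mult = monoid.mult Q, one = one Q, ring.zero = ring.zero Q, ring.add = ring.add Q,
       smult = (\<lambda>c t. pure_tensor K A B (c \<odot>\<^bsub>A\<^esub> \<one>\<^bsub>A\<^esub>) \<one>\<^bsub>B\<^esub> \<otimes>\<^bsub>Q\<^esub> t)\<rparr>)"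

definition tensor_sq ::
    "('k, 'r) ring_scheme \<Rightarrow> ('k, 'a, 'm) module_scheme \<Rightarrow> ('k, ('a \<times> 'a \<Rightarrow>\<^sub>0 int) set) module"
  where "tensor_sq K A = tensor_algebra K A A"

(* A \<otimes> A \<otimes> A, bracketed as (A \<otimes> A) \<otimes> A. *)
definition tensor_cube ::
    "('k, 'r) ring_scheme \<Rightarrow> ('k, 'a, 'm) module_scheme
      \<Rightarrow> ('k, (('a \<times> 'a \<Rightarrow>\<^sub>0 int) set \<times> 'a \<Rightarrow>\<^sub>0 int) set) module"
  where "tensor_cube K A = tensor_algebra K (tensor_sq K A) A"

definition pure2 ::
    "('k, 'r) ring_scheme \<Rightarrow> ('k, 'a, 'm) module_scheme \<Rightarrow> 'a \<Rightarrow> 'a \<Rightarrow> ('a \<times> 'a \<Rightarrow>\<^sub>0 int) set"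
  where "pure2 K A x y = pure_tensor K A A x y"

definition pure3 ::
    "('k, 'r) ring_scheme \<Rightarrow> ('k, 'a, 'm) module_scheme \<Rightarrow> 'a \<Rightarrow> 'a \<Rightarrow> 'a
      \<Rightarrow> (('a \<times> 'a \<Rightarrow>\<^sub>0 int) set \<times> 'a \<Rightarrow>\<^sub>0 int) set"
  where "pure3 K A x y z = pure_tensor K (tensor_sq K A) A (pure2 K A x y) z"

(* r = \<Sum>i\<in>I. u i \<otimes> v i, and the elements r12, r13, r23 obtained from this expression. *)
definition tensor_sum ::
    "('k, 'r) ring_scheme \<Rightarrow> ('k, 'a, 'm) module_scheme \<Rightarrow> 'i set \<Rightarrow> ('i \<Rightarrow> 'a) \<Rightarrow> ('i \<Rightarrow> 'a)
      \<Rightarrow> ('a \<times> 'a \<Rightarrow>\<^sub>0 int) set"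
  where "tensor_sum K A I u v = (\<Oplus>\<^bsub>tensor_sq K A\<^esub> i \<in> I. pure2 K A (u i) (v i))"

definition leg12 ::
    "('k, 'r) ring_scheme \<Rightarrow> ('k, 'a, 'm) module_scheme \<Rightarrow> 'i set \<Rightarrow> ('i \<Rightarrow> 'a) \<Rightarrow> ('i \<Rightarrow> 'a)
      \<Rightarrow> (('a \<times> 'a \<Rightarrow>\<^sub>0 int) set \<times> 'a \<Rightarrow>\<^sub>0 int) set"
  where "leg12 K A I u v = (\<Oplus>\<^bsub>tensor_cube K A\<^esub> i \<in> I. pure3 K A (u i) (v i) \<one>\<^bsub>A\<^esub>)"

definition leg13 ::
    "('k, 'r) ring_scheme \<Rightarrow> ('k, 'a, 'm) module_scheme \<Rightarrow> 'i set \<Rightarrow> ('i \<Rightarrow> 'a) \<Rightarrow> ('i \<Rightarrow> 'a)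
      \<Rightarrow> (('a \<times> 'a \<Rightarrow>\<^sub>0 int) set \<times> 'a \<Rightarrow>\<^sub>0 int) set"
  where "leg13 K A I u v = (\<Oplus>\<^bsub>tensor_cube K A\<^esub> i \<in> I. pure3 K A (u i) \<one>\<^bsub>A\<^esub> (v i))"

definition leg23 ::
    "('k, 'r) ring_scheme \<Rightarrow> ('k, 'a, 'm) module_scheme \<Rightarrow> 'i set \<Rightarrow> ('i \<Rightarrow> 'a) \<Rightarrow> ('i \<Rightarrow> 'a)
      \<Rightarrow> (('a \<times> 'a \<Rightarrow>\<^sub>0 int) set \<times> 'a \<Rightarrow>\<^sub>0 int) set"
  where "leg23 K A I u v = (\<Oplus>\<^bsub>tensor_cube K A\<^esub> i \<in> I. pure3 K A \<one>\<^bsub>A\<^esub> (u i) (v i))"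

(* r12, r13 and r23 depend only on r, not on the expression of r as a finite sum of pure
   tensors, and every r in A \<otimes> A has such an expression; hence it does not matter which
   expression is used here. *)
definition aybe_solution ::
    "('k, 'r) ring_scheme \<Rightarrow> ('k, 'a, 'm) module_scheme \<Rightarrow> 'k \<Rightarrow> ('a \<times> 'a \<Rightarrow>\<^sub>0 int) set \<Rightarrow> bool"
  where "aybe_solution K A lam r \<longleftrightarrow>
    (\<exists>(n::nat) u v. u \<in> {..<n} \<rightarrow> carrier A \<and> v \<in> {..<n} \<rightarrow> carrier A \<and>
      r = tensor_sum K A {..<n} u v \<and>
      (let T = tensor_cube K A;
           r12 = leg12 K A {..<n} u v; r13 = leg13 K A {..<n} u v; r23 = leg23 K A {..<n} u v
       in r13 \<otimes>\<^bsub>T\<^esub> r12 \<ominus>\<^bsub>T\<^esub> r12 \<otimes>\<^bsub>T\<^esub> r23 \<oplus>\<^bsub>T\<^esub> r23 \<otimes>\<^bsub>T\<^esub> r13 = lam \<odot>\<^bsub>T\<^esub> r13))"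

definition linear_operator ::
    "('k, 'r) ring_scheme \<Rightarrow> ('k, 'a, 'm) module_scheme \<Rightarrow> ('a \<Rightarrow> 'a) \<Rightarrow> bool"
  where "linear_operator K A P \<longleftrightarrow>
    P \<in> carrier A \<rightarrow> carrier A \<and>
    (\<forall>a\<in>carrier A. \<forall>b\<in>carrier A. P (a \<oplus>\<^bsub>A\<^esub> b) = P a \<oplus>\<^bsub>A\<^esub> P b) \<and>
    (\<forall>c\<in>carrier K. \<forall>a\<in>carrier A. P (c \<odot>\<^bsub>A\<^esub> a) = c \<odot>\<^bsub>A\<^esub> P a)"

definition rota_baxter_operator ::
    "('k, 'r) ring_scheme \<Rightarrow> ('k, 'a, 'm) module_scheme \<Rightarrow> 'k \<Rightarrow> ('a \<Rightarrow> 'a) \<Rightarrow> bool"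
  where "rota_baxter_operator K A mu P \<longleftrightarrow>
    linear_operator K A P \<and>
    (\<forall>a\<in>carrier A. \<forall>b\<in>carrier A.
      P a \<otimes>\<^bsub>A\<^esub> P b = P (a \<otimes>\<^bsub>A\<^esub> P b) \<oplus>\<^bsub>A\<^esub> P (P a \<otimes>\<^bsub>A\<^esub> b) \<oplus>\<^bsub>A\<^esub> mu \<odot>\<^bsub>A\<^esub> P (a \<otimes>\<^bsub>A\<^esub> b))"

(* P_r for r = \<Sum>i\<in>I. u i \<otimes> v i; as an operator on A it depends only on r. *)
definition sandwich_operator ::
    "('k, 'a, 'm) module_scheme \<Rightarrow> 'i set \<Rightarrow> ('i \<Rightarrow> 'a) \<Rightarrow> ('i \<Rightarrow> 'a) \<Rightarrow> 'a \<Rightarrow> 'a"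
  where "sandwich_operator A I u v a = (\<Oplus>\<^bsub>A\<^esub> i \<in> I. u i \<otimes>\<^bsub>A\<^esub> a \<otimes>\<^bsub>A\<^esub> v i)"

end

theory Submission
  imports Defs
begin

text \<open>For fixed \<open>a\<close> and \<open>b\<close> the universal property of the tensor product gives \<open>K\<close>-linear maps
  \<open>x \<otimes> y \<mapsto> x a y\<close> on \<open>A \<otimes> A\<close> and \<open>x \<otimes> y \<otimes> z \<mapsto> x a y b z\<close> on \<open>A \<otimes> A \<otimes> A\<close>. The first sends \<open>r\<close> to
  \<open>P(a)\<close>, so \<open>P\<close> depends only on \<open>r\<close>. The second sends \<open>r13 r12\<close>, \<open>r12 r23\<close>, \<open>r23 r13\<close> and \<open>r13\<close> to
  \<open>P(P(a) b)\<close>, \<open>P(a) P(b)\<close>, \<open>P(a P(b))\<close> and \<open>P(a b)\<close> respectively, so it turns the associative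
  Yang-Baxter equation into the Rota-Baxter identity.\<close>

section \<open>Integral monoid rings\<close>

text \<open>This identification carries facts about free abelian groups over to the monoid ring:
  commutativity, the form of inverses and, for tensor products, the universal property.\<close>

lemma add_monoid_monoid_ring:
  "add_monoid (monoid_ring G) = free_Abelian_group (carrier G)"
  by (simp add: monoid_ring_def free_Abelian_group_def)

lemma abelian_group_monoid_ring: "abelian_group (monoid_ring G)"
  by (rule comm_group_abelian_groupI) (simp only: add_monoid_monoid_ring abelian_free_Abelian_group)

lemma monoid_ring_carrier_iff: "f \<in> carrier (monoid_ring G) \<longleftrightarrow> Poly_Mapping.keys f \<subseteq> carrier G"
  by (simp add: monoid_ring_def)

lemma monoid_ring_simps [simp]:
  "\<zero>\<^bsub>monoid_ring G\<^esub> = 0"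
  "\<one>\<^bsub>monoid_ring G\<^esub> = frag_of \<one>\<^bsub>G\<^esub>"
  "f \<oplus>\<^bsub>monoid_ring G\<^esub> g = f + g"
  "frag_of x \<in> carrier (monoid_ring G) \<longleftrightarrow> x \<in> carrier G"
  by (simp_all add: monoid_ring_def)

text \<open>The inverse in the additive group is specified only on the carrier, while pointwise
  subtraction is total. Where they agree, the pointwise form is easier to use, since the relators
  are written in it.\<close>

lemma monoid_ring_a_minus [simp]:
  assumes "f \<in> carrier (monoid_ring G)" "g \<in> carrier (monoid_ring G)"
  shows "f \<ominus>\<^bsub>monoid_ring G\<^esub> g = f - g"
proof -
  have "\<ominus>\<^bsub>monoid_ring G\<^esub> g = - g"
    using assms(2) unfolding a_inv_def add_monoid_monoid_ring
    by (intro inv_free_Abelian_group) (simp add: monoid_ring_carrier_iff)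
  then show ?thesis
    by (simp add: a_minus_def)
qed

lemma monoid_ring_zero_closed [simp]: "0 \<in> carrier (monoid_ring G)"
  by (simp add: monoid_ring_carrier_iff)

lemma monoid_ring_add_closed [simp]:
  assumes "f \<in> carrier (monoid_ring G)" "g \<in> carrier (monoid_ring G)"
  shows "f + g \<in> carrier (monoid_ring G)"
  using assms keys_add[of f g] by (auto simp: monoid_ring_carrier_iff)

lemma monoid_ring_diff_closed [simp]:
  assumes "f \<in> carrier (monoid_ring G)" "g \<in> carrier (monoid_ring G)"
  shows "f - g \<in> carrier (monoid_ring G)"
  using assms keys_diff[of f g] by (auto simp: monoid_ring_carrier_iff)

text \<open>The basis elements generate the group under subtraction alone, so one case for
  differences covers both sums and negatives.\<close>

lemma monoid_ring_induct [consumes 1, case_names zero diff of]: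
  assumes "f \<in> carrier (monoid_ring G)"
    and "P 0"
    and "\<And>f g. \<lbrakk>f \<in> carrier (monoid_ring G); g \<in> carrier (monoid_ring G); P f; P g\<rbrakk> \<Longrightarrow> P (f - g)"
    and "\<And>x. x \<in> carrier G \<Longrightarrow> P (frag_of x)"
  shows "P f"
  using free_Abelian_group_induct[of f "carrier G" P] assms by (simp add: monoid_ring_carrier_iff)

lemma monoid_ring_mult_of [simp]:
  "frag_of x \<otimes>\<^bsub>monoid_ring G\<^esub> frag_of y = frag_of (x \<otimes>\<^bsub>G\<^esub> y)"
  by (simp add: monoid_ring_def)

lemma monoid_ring_mult_zero_left [simp]: "0 \<otimes>\<^bsub>monoid_ring G\<^esub> g = 0"
  by (simp add: monoid_ring_def)

lemma monoid_ring_mult_diff_left: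
  "(f - g) \<otimes>\<^bsub>monoid_ring G\<^esub> h = f \<otimes>\<^bsub>monoid_ring G\<^esub> h - g \<otimes>\<^bsub>monoid_ring G\<^esub> h"
  by (simp add: monoid_ring_def frag_extend_diff)

lemma monoid_ring_mult_add_left:
  "(f + g) \<otimes>\<^bsub>monoid_ring G\<^esub> h = f \<otimes>\<^bsub>monoid_ring G\<^esub> h + g \<otimes>\<^bsub>monoid_ring G\<^esub> h"
  by (simp add: monoid_ring_def frag_extend_add)

lemma monoid_ring_mult_add_right:
  "f \<otimes>\<^bsub>monoid_ring G\<^esub> (g + h) = f \<otimes>\<^bsub>monoid_ring G\<^esub> g + f \<otimes>\<^bsub>monoid_ring G\<^esub> h"
  \<comment> \<open>The second factor sits inside the function that the outer
    \<open>frag_extend\<close> extends. The outer extension is therefore opened as a finite sum over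
    the support of \<open>f\<close>, and the sum is split termwise.\<close>
  by (simp add: monoid_ring_def frag_extend_add) (simp add: frag_extend_def frag_cmul_distrib2 sum.distrib)

lemma monoid_ring_mult_zero_right [simp]: "f \<otimes>\<^bsub>monoid_ring G\<^esub> 0 = 0"
  using monoid_ring_mult_add_right[of G f 0 0] by simp

lemma monoid_ring_mult_diff_right:
  "f \<otimes>\<^bsub>monoid_ring G\<^esub> (g - h) = f \<otimes>\<^bsub>monoid_ring G\<^esub> g - f \<otimes>\<^bsub>monoid_ring G\<^esub> h"
  using monoid_ring_mult_add_right[of G f "g - h" h] by simp

text \<open>The product is biadditive, so closure, associativity and the unit laws need checking
  only on basis elements, where they are the laws of \<open>G\<close>. The nested inductions reduce
  one variable at a time.\<close>

lemma ring_monoid_ring: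
  assumes "Group.monoid G"
  shows "ring (monoid_ring G)"
proof -
  interpret G: Group.monoid G by fact
  let ?M = "monoid_ring G"
  have closed: "f \<otimes>\<^bsub>?M\<^esub> g \<in> carrier ?M" if f: "f \<in> carrier ?M" and g: "g \<in> carrier ?M" for f g
    using f
  proof (induction f rule: monoid_ring_induct)
    case (of x)
    show ?case
      using g by (induction g rule: monoid_ring_induct) (use of in \<open>auto simp: monoid_ring_mult_diff_right\<close>)
  qed (auto simp: monoid_ring_mult_diff_left)
  have assoc: "(f \<otimes>\<^bsub>?M\<^esub> g) \<otimes>\<^bsub>?M\<^esub> h = f \<otimes>\<^bsub>?M\<^esub> (g \<otimes>\<^bsub>?M\<^esub> h)"
    if f: "f \<in> carrier ?M" and g: "g \<in> carrier ?M" and h: "h \<in> carrier ?M" for f g h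
    using f
  proof (induction f rule: monoid_ring_induct)
    case (of x)
    show ?case
      using g
    proof (induction g rule: monoid_ring_induct)
      case (of y)
      show ?case
        using h by (induction h rule: monoid_ring_induct)
          (use \<open>x \<in> carrier G\<close> of in \<open>auto simp: monoid_ring_mult_diff_right G.m_assoc\<close>)
    qed (auto simp: monoid_ring_mult_diff_left monoid_ring_mult_diff_right)
  qed (auto simp: monoid_ring_mult_diff_left)
  show ?thesis
  proof (rule ringI)
    show "abelian_group ?M"
      by (rule abelian_group_monoid_ring)
    show "Group.monoid ?M"
    proof (rule monoidI)
      show "\<one>\<^bsub>?M\<^esub> \<otimes>\<^bsub>?M\<^esub> f = f" if "f \<in> carrier ?M" for f
        using that by (induction f rule: monoid_ring_induct) (auto simp: monoid_ring_mult_diff_right)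
      show "f \<otimes>\<^bsub>?M\<^esub> \<one>\<^bsub>?M\<^esub> = f" if "f \<in> carrier ?M" for f
        using that by (induction f rule: monoid_ring_induct) (auto simp: monoid_ring_mult_diff_left)
    qed (simp_all add: closed assoc)
  qed (simp_all add: monoid_ring_mult_add_left monoid_ring_mult_add_right)
qed

text \<open>\<open>tensor_algebra\<close> is the quotient ring with a scalar action attached, hence
  a different record. The ring axioms see only the five fields compared here and so carry
  over.\<close>

lemma ring_cong:
  assumes "ring R" "carrier S = carrier R" "monoid.mult S = monoid.mult R" "one S = one R"
    "ring.zero S = ring.zero R" "ring.add S = ring.add R"
  shows "ring S"
proof -
  interpret ring R by fact
  have "abelian_group S"
  proof (rule abelian_groupI)
    show "\<exists>y\<in>carrier S. y \<oplus>\<^bsub>S\<^esub> x = \<zero>\<^bsub>S\<^esub>" if "x \<in> carrier S" for x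
      by (rule bexI[of _ "\<ominus>\<^bsub>R\<^esub> x"]) (use that in \<open>simp_all add: assms l_neg\<close>)
  qed (simp_all add: assms a_ac)
  moreover have "Group.monoid S"
    by (rule monoidI) (simp_all add: assms m_assoc)
  ultimately show ?thesis
    by (rule ringI) (simp_all add: assms l_distr r_distr)
qed

context abelian_group_hom
begin

lemma hom_a_minus [simp]:
  "\<lbrakk>x \<in> carrier G; y \<in> carrier G\<rbrakk> \<Longrightarrow> h (x \<ominus>\<^bsub>G\<^esub> y) = h x \<ominus>\<^bsub>H\<^esub> h y"
  by (simp add: a_minus_def)

lemma hom_finsum:
  assumes "f \<in> I \<rightarrow> carrier G"
  shows "h (\<Oplus>\<^bsub>G\<^esub>i\<in>I. f i) = (\<Oplus>\<^bsub>H\<^esub>i\<in>I. h (f i))"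
  using assms
  \<comment> \<open>For infinite \<open>I\<close> both sums take the default value zero, which
    \<open>h\<close> preserves; hence no finiteness assumption.\<close>
  by (induction I rule: infinite_finite_induct) (auto simp: Pi_iff)

end

section \<open>Tensor products of algebras\<close>

locale tensor_product =
  A: assoc_algebra K A + B: assoc_algebra K B
  for K :: "('k, 'r) ring_scheme" (structure)
    and A :: "('k, 'a, 'm) module_scheme"
    and B :: "('k, 'b, 'n) module_scheme"
begin

abbreviation M where "M \<equiv> monoid_ring (A \<times>\<times> B)"
abbreviation J where "J \<equiv> tensor_ideal K A B"
abbreviation T where "T \<equiv> tensor_algebra K A B"
abbreviation tensor (infixl "\<otimes>\<^sub>T" 72) where "x \<otimes>\<^sub>T y \<equiv> pure_tensor K A B x y"

sublocale M: ring M
  by (intro ring_monoid_ring DirProd_monoid) unfold_locales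

section \<open>The relators and the ideal they generate\<close>

lemma tensor_relators_closed: "tensor_relators K A B \<subseteq> carrier M"
  by (auto simp: tensor_relators_def)

lemma tensor_relatorsI:
  shows "\<lbrakk>x \<in> carrier A; x' \<in> carrier A; y \<in> carrier B\<rbrakk>
      \<Longrightarrow> frag_of (x \<oplus>\<^bsub>A\<^esub> x', y) - frag_of (x, y) - frag_of (x', y) \<in> tensor_relators K A B"
    and "\<lbrakk>x \<in> carrier A; y \<in> carrier B; y' \<in> carrier B\<rbrakk>
      \<Longrightarrow> frag_of (x, y \<oplus>\<^bsub>B\<^esub> y') - frag_of (x, y) - frag_of (x, y') \<in> tensor_relators K A B"
    and "\<lbrakk>c \<in> carrier K; x \<in> carrier A; y \<in> carrier B\<rbrakk>
      \<Longrightarrow> frag_of (c \<odot>\<^bsub>A\<^esub> x, y) - frag_of (x, c \<odot>\<^bsub>B\<^esub> y) \<in> tensor_relators K A B"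
  unfolding tensor_relators_def by blast+

lemma tensor_relators_cases [consumes 1, case_names add_left add_right balanced]:
  assumes "q \<in> tensor_relators K A B"
  obtains x x' y where "q = frag_of (x \<oplus>\<^bsub>A\<^esub> x', y) - frag_of (x, y) - frag_of (x', y)"
      "x \<in> carrier A" "x' \<in> carrier A" "y \<in> carrier B"
    | x y y' where "q = frag_of (x, y \<oplus>\<^bsub>B\<^esub> y') - frag_of (x, y) - frag_of (x, y')"
      "x \<in> carrier A" "y \<in> carrier B" "y' \<in> carrier B"
    | c x y where "q = frag_of (c \<odot>\<^bsub>A\<^esub> x, y) - frag_of (x, c \<odot>\<^bsub>B\<^esub> y)"
      "c \<in> carrier K" "x \<in> carrier A" "y \<in> carrier B"
  using assms unfolding tensor_relators_def
  by (elim UnE CollectE exE conjE) (erule (3) that)+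

text \<open>In each factor, multiplication by a fixed element is additive and commutes with scalars,
  so a basis element times a relator is a relator of the same kind. This is what makes the additive
  subgroup generated by the relators an ideal.\<close>

lemma tensor_relators_mult:
  assumes "q \<in> tensor_relators K A B" "z \<in> carrier A" "w \<in> carrier B"
  shows "frag_of (z, w) \<otimes>\<^bsub>M\<^esub> q \<in> tensor_relators K A B"
    and "q \<otimes>\<^bsub>M\<^esub> frag_of (z, w) \<in> tensor_relators K A B"
proof -
  have "frag_of (z, w) \<otimes>\<^bsub>M\<^esub> q \<in> tensor_relators K A B \<and> q \<otimes>\<^bsub>M\<^esub> frag_of (z, w) \<in> tensor_relators K A B"
    using assms(1)
  proof (cases rule: tensor_relators_cases)
    case (add_left x x' y)
    then show ?thesis
      using assms(2,3) tensor_relatorsI(1)[of "z \<otimes>\<^bsub>A\<^esub> x" "z \<otimes>\<^bsub>A\<^esub> x'" "w \<otimes>\<^bsub>B\<^esub> y"]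
        tensor_relatorsI(1)[of "x \<otimes>\<^bsub>A\<^esub> z" "x' \<otimes>\<^bsub>A\<^esub> z" "y \<otimes>\<^bsub>B\<^esub> w"]
      by (simp add: monoid_ring_mult_diff_left monoid_ring_mult_diff_right A.l_distr A.r_distr)
  next
    case (add_right x y y')
    then show ?thesis
      using assms(2,3) tensor_relatorsI(2)[of "z \<otimes>\<^bsub>A\<^esub> x" "w \<otimes>\<^bsub>B\<^esub> y" "w \<otimes>\<^bsub>B\<^esub> y'"]
        tensor_relatorsI(2)[of "x \<otimes>\<^bsub>A\<^esub> z" "y \<otimes>\<^bsub>B\<^esub> w" "y' \<otimes>\<^bsub>B\<^esub> w"]
      by (simp add: monoid_ring_mult_diff_left monoid_ring_mult_diff_right B.l_distr B.r_distr)
  next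
    case (balanced c x y)
    then show ?thesis
      using assms(2,3) tensor_relatorsI(3)[of c "z \<otimes>\<^bsub>A\<^esub> x" "w \<otimes>\<^bsub>B\<^esub> y"]
        tensor_relatorsI(3)[of c "x \<otimes>\<^bsub>A\<^esub> z" "y \<otimes>\<^bsub>B\<^esub> w"]
      by (simp add: monoid_ring_mult_diff_left monoid_ring_mult_diff_right
          A.smult_mult_left A.smult_mult_right B.smult_mult_left B.smult_mult_right)
  qed
  then show "frag_of (z, w) \<otimes>\<^bsub>M\<^esub> q \<in> tensor_relators K A B"
    and "q \<otimes>\<^bsub>M\<^esub> frag_of (z, w) \<in> tensor_relators K A B"
    by blast+
qed

lemma tensor_ideal_subgroup: "subgroup J (add_monoid M)"
  unfolding tensor_ideal_def
  by (rule M.add.generate_is_subgroup) (use tensor_relators_closed in simp)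

lemma ideal_tensor_ideal: "ideal J M"
proof (rule idealI)
  interpret J: subgroup J "add_monoid M" by (rule tensor_ideal_subgroup)
  have incl: "q \<in> J" if "q \<in> tensor_relators K A B" for q
    using that unfolding tensor_ideal_def by (rule generate.incl)
  have diff: "f - g \<in> J" if "f \<in> J" "g \<in> J" for f g
  proof -
    have "f \<oplus>\<^bsub>M\<^esub> \<ominus>\<^bsub>M\<^esub> g \<in> J"
      using J.m_closed[OF that(1) J.m_inv_closed[OF that(2)]] unfolding a_inv_def by simp
    moreover have "f \<in> carrier M" "g \<in> carrier M"
      using that J.subset by auto
    ultimately show ?thesis
      using monoid_ring_a_minus[of f "A \<times>\<times> B" g] by (simp add: a_minus_def)
  qed
  have zero: "0 \<in> J"
    using J.one_closed by simp
  \<comment> \<open>The elements all of whose left and right multiples lie in \<open>J\<close>. By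
    distributivity they form a subgroup; since this subgroup contains the relators, it contains all
    of \<open>J\<close>, which is the absorption property.\<close>
  let ?S = "{q \<in> carrier M. \<forall>f\<in>carrier M. f \<otimes>\<^bsub>M\<^esub> q \<in> J \<and> q \<otimes>\<^bsub>M\<^esub> f \<in> J}"
  \<comment> \<open>Induction on the multiplier leaves only basis elements, whose products with a
    relator are again relators.\<close>
  have rel: "q \<in> ?S" if "q \<in> tensor_relators K A B" for q
  proof -
    have "f \<otimes>\<^bsub>M\<^esub> q \<in> J \<and> q \<otimes>\<^bsub>M\<^esub> f \<in> J" if "f \<in> carrier M" for f
      using that
      by (induction f rule: monoid_ring_induct)
        (use \<open>q \<in> tensor_relators K A B\<close> in \<open>auto simp: monoid_ring_mult_diff_left
          monoid_ring_mult_diff_right zero diff incl tensor_relators_mult\<close>)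
    then show ?thesis
      using that tensor_relators_closed by auto
  qed
  have "subgroup ?S (add_monoid M)"
  proof (rule M.add.subgroupI)
    show "f \<oplus>\<^bsub>M\<^esub> g \<in> ?S" if "f \<in> ?S" "g \<in> ?S" for f g
      using that J.m_closed by (auto simp: M.l_distr M.r_distr simp del: monoid_ring_simps)
    show "\<ominus>\<^bsub>M\<^esub> f \<in> ?S" if "f \<in> ?S" for f
      using that J.m_inv_closed[folded a_inv_def] by (auto simp: M.l_minus M.r_minus)
    show "?S \<noteq> {}"
      using zero monoid_ring_zero_closed by force
  qed auto
  then have "generate (add_monoid M) (tensor_relators K A B) \<subseteq> ?S"
    using rel by (intro M.add.generate_subgroup_incl subsetI)
  then have sub: "J \<subseteq> ?S"
    by (simp only: tensor_ideal_def)
  show "x \<otimes>\<^bsub>M\<^esub> a \<in> J" "a \<otimes>\<^bsub>M\<^esub> x \<in> J" if "a \<in> J" "x \<in> carrier M" for a x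
    using that sub by auto
qed (rule M.ring_axioms tensor_ideal_subgroup)+

sublocale J: ideal J M
  by (rule ideal_tensor_ideal)

section \<open>The quotient ring and its pure tensors\<close>

lemma tensor_algebra_Quot:
  "carrier T = carrier (M Quot J)" "monoid.mult T = monoid.mult (M Quot J)"
  "one T = one (M Quot J)" "ring.zero T = ring.zero (M Quot J)" "ring.add T = ring.add (M Quot J)"
  by (simp_all add: tensor_algebra_def Let_def)

sublocale T: ring T
  by (rule ring_cong[OF J.quotient_is_ring tensor_algebra_Quot])

lemma proj_ring_hom: "ring_hom_ring M T ((+>\<^bsub>M\<^esub>) J)"
proof (rule ring_hom_ringI2)
  show "(+>\<^bsub>M\<^esub>) J \<in> ring_hom M T"
    using J.rcos_ring_hom by (simp add: ring_hom_def tensor_algebra_Quot)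
qed (rule M.ring_axioms T.ring_axioms)+

lemma proj_surj: "carrier T = (+>\<^bsub>M\<^esub>) J ` carrier M"
  unfolding tensor_algebra_Quot by (auto simp: FactRing_def A_RCOSETS_def RCOSETS_def a_r_coset_def)

lemma proj_zero: "J +>\<^bsub>M\<^esub> 0 = \<zero>\<^bsub>T\<^esub>"
  using ring_hom_ring.homh[OF proj_ring_hom] ring_hom_zero[OF _ M.ring_axioms T.ring_axioms] by force

lemma proj_add:
  assumes "f \<in> carrier M" "g \<in> carrier M"
  shows "J +>\<^bsub>M\<^esub> (f + g) = (J +>\<^bsub>M\<^esub> f) \<oplus>\<^bsub>T\<^esub> (J +>\<^bsub>M\<^esub> g)"
  using ring_hom_add[OF ring_hom_ring.homh[OF proj_ring_hom] assms] by simp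

lemma proj_mult:
  assumes "f \<in> carrier M" "g \<in> carrier M"
  shows "J +>\<^bsub>M\<^esub> (f \<otimes>\<^bsub>M\<^esub> g) = (J +>\<^bsub>M\<^esub> f) \<otimes>\<^bsub>T\<^esub> (J +>\<^bsub>M\<^esub> g)"
  using ring_hom_mult[OF ring_hom_ring.homh[OF proj_ring_hom] assms] .

lemma proj_closed:
  assumes "f \<in> carrier M"
  shows "J +>\<^bsub>M\<^esub> f \<in> carrier T"
  using assms by (simp add: proj_surj)

lemma proj_diff:
  assumes "f \<in> carrier M" "g \<in> carrier M"
  shows "J +>\<^bsub>M\<^esub> (f - g) = (J +>\<^bsub>M\<^esub> f) \<ominus>\<^bsub>T\<^esub> (J +>\<^bsub>M\<^esub> g)"
  using proj_add[of "f - g" g] proj_closed[of f] proj_closed[of g] proj_closed[of "f - g"] assms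
  by (simp add: T.minus_eq T.a_assoc T.r_neg)

text \<open>Relators lie in \<open>J\<close>, so each of them becomes an identity between tensors
  after projection.\<close>

lemma proj_eqI:
  assumes "f \<in> carrier M" "g \<in> carrier M" "f - g \<in> tensor_relators K A B"
  shows "J +>\<^bsub>M\<^esub> f = J +>\<^bsub>M\<^esub> g"
proof -
  have "f - g \<in> J"
    unfolding tensor_ideal_def using assms(3) by (rule generate.incl)
  then show ?thesis
    using M.quotient_eq_iff_same_a_r_cos[OF ideal_tensor_ideal assms(1,2)] assms(1,2) by simp
qed

lemma tensor_closed [simp]:
  assumes "x \<in> carrier A" "y \<in> carrier B"
  shows "x \<otimes>\<^sub>T y \<in> carrier T"
  using assms by (auto simp: proj_surj pure_tensor_def)

lemma tensor_add_left:
  assumes "x \<in> carrier A" "x' \<in> carrier A" "y \<in> carrier B"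
  shows "(x \<oplus>\<^bsub>A\<^esub> x') \<otimes>\<^sub>T y = x \<otimes>\<^sub>T y \<oplus>\<^bsub>T\<^esub> x' \<otimes>\<^sub>T y"
proof -
  have "frag_of (x \<oplus>\<^bsub>A\<^esub> x', y) - (frag_of (x, y) + frag_of (x', y)) \<in> tensor_relators K A B"
    \<comment> \<open>\<open>proj_eqI\<close> wants a single difference \<open>f - g\<close>;
      unfolding it into iterated subtraction gives the shape in which the relator is listed.\<close>
    using assms by (simp add: tensor_relatorsI flip: diff_diff_eq)
  then have "J +>\<^bsub>M\<^esub> frag_of (x \<oplus>\<^bsub>A\<^esub> x', y) = J +>\<^bsub>M\<^esub> (frag_of (x, y) + frag_of (x', y))"
    by (rule proj_eqI[rotated 2]) (use assms in simp_all)
  then show ?thesis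
    using assms by (simp add: pure_tensor_def proj_add)
qed

lemma tensor_mult:
  assumes "x \<in> carrier A" "x' \<in> carrier A" "y \<in> carrier B" "y' \<in> carrier B"
  shows "(x \<otimes>\<^sub>T y) \<otimes>\<^bsub>T\<^esub> (x' \<otimes>\<^sub>T y') = (x \<otimes>\<^bsub>A\<^esub> x') \<otimes>\<^sub>T (y \<otimes>\<^bsub>B\<^esub> y')"
proof -
  show ?thesis
    using assms by (simp add: pure_tensor_def flip: proj_mult)
qed

lemma tensor_one: "\<one>\<^bsub>A\<^esub> \<otimes>\<^sub>T \<one>\<^bsub>B\<^esub> = \<one>\<^bsub>T\<^esub>"
  by (simp add: pure_tensor_def tensor_algebra_Quot FactRing_def)

text \<open>Every tensor is the coset of an element of the monoid ring, and basis elements project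
  to pure tensors, so induction on a representative descends to the quotient.\<close>

lemma tensor_algebra_induct [consumes 1, case_names zero diff tensor]:
  assumes "t \<in> carrier T"
    and "P \<zero>\<^bsub>T\<^esub>"
    and "\<And>s t. \<lbrakk>s \<in> carrier T; t \<in> carrier T; P s; P t\<rbrakk> \<Longrightarrow> P (s \<ominus>\<^bsub>T\<^esub> t)"
    and "\<And>x y. \<lbrakk>x \<in> carrier A; y \<in> carrier B\<rbrakk> \<Longrightarrow> P (x \<otimes>\<^sub>T y)"
  shows "P t"
proof -
  obtain f where "f \<in> carrier M" "t = J +>\<^bsub>M\<^esub> f"
    using assms(1) by (auto simp: proj_surj)
  moreover have "P (J +>\<^bsub>M\<^esub> f)" if "f \<in> carrier M" for f
    using that
  proof (induction f rule: monoid_ring_induct)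
    case zero
    then show ?case
      using assms(2) proj_zero by simp
  next
    case (diff f g)
    then show ?case
      by (simp add: proj_diff proj_closed assms(3))
  next
    case (of z)
    then show ?case
      using assms(4)[of "fst z" "snd z"] by (auto simp: pure_tensor_def)
  qed
  ultimately show ?thesis
    by simp
qed

section \<open>The scalar action on the tensor product\<close>

lemma smult_tensor_algebra:
  "c \<odot>\<^bsub>T\<^esub> t = ((c \<odot>\<^bsub>A\<^esub> \<one>\<^bsub>A\<^esub>) \<otimes>\<^sub>T \<one>\<^bsub>B\<^esub>) \<otimes>\<^bsub>T\<^esub> t"
  by (simp add: tensor_algebra_def Let_def)

lemma smult_tensor:
  assumes "c \<in> carrier K" "x \<in> carrier A" "y \<in> carrier B"
  shows "c \<odot>\<^bsub>T\<^esub> (x \<otimes>\<^sub>T y) = (c \<odot>\<^bsub>A\<^esub> x) \<otimes>\<^sub>T y"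
  using assms by (simp add: smult_tensor_algebra tensor_mult A.smult_mult_left)

text \<open>On a pure tensor both products scale the left factor by \<open>c\<close>; distributivity
  extends this to all tensors. It supplies the compatibility of scalars with the right factor of a
  product.\<close>

lemma scalar_central:
  assumes "c \<in> carrier K" "t \<in> carrier T"
  shows "((c \<odot>\<^bsub>A\<^esub> \<one>\<^bsub>A\<^esub>) \<otimes>\<^sub>T \<one>\<^bsub>B\<^esub>) \<otimes>\<^bsub>T\<^esub> t = t \<otimes>\<^bsub>T\<^esub> ((c \<odot>\<^bsub>A\<^esub> \<one>\<^bsub>A\<^esub>) \<otimes>\<^sub>T \<one>\<^bsub>B\<^esub>)"
  using assms(2)
proof (induction t rule: tensor_algebra_induct)
  case (diff s t)
  then show ?case
    using assms(1) by (simp add: a_minus_def T.l_distr T.r_distr T.l_minus T.r_minus)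
qed (use assms(1) in \<open>simp_all add: tensor_mult A.smult_mult_left A.smult_mult_right\<close>)

text \<open>As \<open>c\<close> acts by multiplication with a fixed element, the module axioms
  become distributivity, associativity and unit laws in \<open>T\<close>. That the result is again
  an algebra permits iterated tensor products.\<close>

lemma assoc_algebra_tensor_algebra: "assoc_algebra K T"
proof (intro assoc_algebra.intro assoc_algebra_axioms.intro moduleI)
  show "cring K" "ring T" "abelian_group T" by unfold_locales
  fix c x assume c: "c \<in> carrier K" and x: "x \<in> carrier T"
  show "c \<odot>\<^bsub>T\<^esub> x \<in> carrier T"
    using c x by (simp add: smult_tensor_algebra)
  fix y assume y: "y \<in> carrier T"
  show "c \<odot>\<^bsub>T\<^esub> (x \<oplus>\<^bsub>T\<^esub> y) = c \<odot>\<^bsub>T\<^esub> x \<oplus>\<^bsub>T\<^esub> c \<odot>\<^bsub>T\<^esub> y"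
    using c x y by (simp add: smult_tensor_algebra T.r_distr)
  show "(c \<odot>\<^bsub>T\<^esub> x) \<otimes>\<^bsub>T\<^esub> y = c \<odot>\<^bsub>T\<^esub> (x \<otimes>\<^bsub>T\<^esub> y)"
    using c x y by (simp add: smult_tensor_algebra T.m_assoc)
  show "x \<otimes>\<^bsub>T\<^esub> (c \<odot>\<^bsub>T\<^esub> y) = c \<odot>\<^bsub>T\<^esub> (x \<otimes>\<^bsub>T\<^esub> y)"
    using c x y scalar_central[OF c x] by (simp add: smult_tensor_algebra flip: T.m_assoc)
next
  fix c d x assume c: "c \<in> carrier K" and d: "d \<in> carrier K" and x: "x \<in> carrier T"
  show "(c \<oplus> d) \<odot>\<^bsub>T\<^esub> x = c \<odot>\<^bsub>T\<^esub> x \<oplus>\<^bsub>T\<^esub> d \<odot>\<^bsub>T\<^esub> x"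
    using c d x by (simp add: smult_tensor_algebra A.smult_l_distr tensor_add_left T.l_distr)
  \<comment> \<open>Multiplicativity of the map sending \<open>c\<close> to c1 \<otimes> 1, from
    which associativity of the action follows.\<close>
  have "((c \<otimes> d) \<odot>\<^bsub>A\<^esub> \<one>\<^bsub>A\<^esub>) \<otimes>\<^sub>T \<one>\<^bsub>B\<^esub> =
      ((c \<odot>\<^bsub>A\<^esub> \<one>\<^bsub>A\<^esub>) \<otimes>\<^sub>T \<one>\<^bsub>B\<^esub>) \<otimes>\<^bsub>T\<^esub> ((d \<odot>\<^bsub>A\<^esub> \<one>\<^bsub>A\<^esub>) \<otimes>\<^sub>T \<one>\<^bsub>B\<^esub>)"
    using c d by (simp add: tensor_mult A.smult_mult_left A.smult_assoc1)
  then show "(c \<otimes> d) \<odot>\<^bsub>T\<^esub> x = c \<odot>\<^bsub>T\<^esub> (d \<odot>\<^bsub>T\<^esub> x)"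
    using c d x by (simp add: smult_tensor_algebra T.m_assoc)
next
  fix x assume "x \<in> carrier T"
  then show "\<one> \<odot>\<^bsub>T\<^esub> x = x"
    by (simp add: smult_tensor_algebra tensor_one)
qed

text \<open>By freeness \<open>f\<close> extends additively to the monoid ring of pairs. The
  hypotheses on \<open>f\<close> say that this extension kills the three kinds of relators, so it
  kills \<open>J\<close> and factors through the quotient.\<close>

lemma tensor_algebra_universal:
  assumes "abelian_group N"
    and closed: "\<And>x y. \<lbrakk>x \<in> carrier A; y \<in> carrier B\<rbrakk> \<Longrightarrow> f x y \<in> carrier N"
    and add_left: "\<And>x x' y. \<lbrakk>x \<in> carrier A; x' \<in> carrier A; y \<in> carrier B\<rbrakk>
      \<Longrightarrow> f (x \<oplus>\<^bsub>A\<^esub> x') y = f x y \<oplus>\<^bsub>N\<^esub> f x' y"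
    and add_right: "\<And>x y y'. \<lbrakk>x \<in> carrier A; y \<in> carrier B; y' \<in> carrier B\<rbrakk>
      \<Longrightarrow> f x (y \<oplus>\<^bsub>B\<^esub> y') = f x y \<oplus>\<^bsub>N\<^esub> f x y'"
    and balanced: "\<And>c x y. \<lbrakk>c \<in> carrier K; x \<in> carrier A; y \<in> carrier B\<rbrakk>
      \<Longrightarrow> f (c \<odot>\<^bsub>A\<^esub> x) y = f x (c \<odot>\<^bsub>B\<^esub> y)"
  shows "\<exists>h. abelian_group_hom T N h \<and> (\<forall>x\<in>carrier A. \<forall>y\<in>carrier B. h (x \<otimes>\<^sub>T y) = f x y)"
proof -
  interpret N: abelian_group N by fact
  obtain g where g: "g \<in> hom (free_Abelian_group (carrier (A \<times>\<times> B))) (add_monoid N)"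
    and g_of: "\<And>z. z \<in> carrier (A \<times>\<times> B) \<Longrightarrow> g (frag_of z) = case_prod f z"
    using N.add.free_Abelian_group_universal[of "case_prod f" "carrier (A \<times>\<times> B)"] closed
    by (auto simp: image_subset_iff)
  have "group_hom (add_monoid M) (add_monoid N) g"
    using g unfolding add_monoid_monoid_ring
    by (intro group_hom.intro group_hom_axioms.intro group_free_Abelian_group N.a_group)
  then have "abelian_group_hom M N g"
    by (intro abelian_group_hom.intro abelian_group_hom_axioms.intro abelian_group_monoid_ring N.abelian_group_axioms)
  then interpret g: abelian_group_hom M N g .
  have g_diff: "g (p - q) = g p \<ominus>\<^bsub>N\<^esub> g q" if "p \<in> carrier M" "q \<in> carrier M" for p q
    using that g.hom_a_minus[of p q] by simp
  \<comment> \<open>The two shapes that the value of a relator takes under \<open>g\<close>: this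
    one for the additivity relators, the next for the balancing relators.\<close>
  have cancel: "a \<oplus>\<^bsub>N\<^esub> b \<ominus>\<^bsub>N\<^esub> a \<ominus>\<^bsub>N\<^esub> b = \<zero>\<^bsub>N\<^esub>" if "a \<in> carrier N" "b \<in> carrier N" for a b
    using that N.a_comm[of a b] by (simp add: N.minus_eq N.a_assoc N.r_neg)
  have cancel': "a \<ominus>\<^bsub>N\<^esub> a = \<zero>\<^bsub>N\<^esub>" if "a \<in> carrier N" for a
    using that by (simp add: N.minus_eq N.r_neg)
  have "g q = \<zero>\<^bsub>N\<^esub>" if "q \<in> tensor_relators K A B" for q
    using that
    by (cases rule: tensor_relators_cases)
      (simp_all add: g_diff g_of closed add_left add_right balanced cancel cancel')
  then have rel: "tensor_relators K A B \<subseteq> a_kernel M N g"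
    unfolding a_kernel_def' using tensor_relators_closed by blast
  have ker: "J \<subseteq> a_kernel M N g"
    unfolding tensor_ideal_def
    by (rule M.add.generate_subgroup_incl[OF rel additive_subgroup.a_subgroup[OF g.additive_subgroup_a_kernel]])
  \<comment> \<open>Vanishing on \<open>J\<close> makes \<open>g\<close> constant on cosets, so the
    choice of representative below is harmless.\<close>
  have g_eq: "g p = g q" if "p \<in> carrier M" "q \<in> carrier M" "J +>\<^bsub>M\<^esub> p = J +>\<^bsub>M\<^esub> q" for p q
  proof -
    have "p \<ominus>\<^bsub>M\<^esub> q \<in> J"
      using that M.quotient_eq_iff_same_a_r_cos[OF ideal_tensor_ideal] by blast
    then have "g (p \<ominus>\<^bsub>M\<^esub> q) = \<zero>\<^bsub>N\<^esub>"
      using ker unfolding a_kernel_def' by blast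
    then have "g p \<ominus>\<^bsub>N\<^esub> g q = \<zero>\<^bsub>N\<^esub>"
      using that g.hom_a_minus[of p q] by simp
    then show ?thesis
      using that N.minus_equality[of "g p" "\<ominus>\<^bsub>N\<^esub> g q"] by (simp add: N.minus_eq)
  qed
  \<comment> \<open>A coset is sent to the value of \<open>g\<close> at some representative; on
    cosets of ring elements \<open>g_eq\<close> makes the value independent of the choice.\<close>
  define h where "h t = g (SOME p. p \<in> carrier M \<and> t = J +>\<^bsub>M\<^esub> p)" for t
  have h: "h (J +>\<^bsub>M\<^esub> p) = g p" if "p \<in> carrier M" for p
    unfolding h_def using that by (rule_tac someI2[of _ p]) (auto intro: g_eq[symmetric])
  have "h \<in> hom (add_monoid T) (add_monoid N)"
  proof (rule homI)
    fix s t assume "s \<in> carrier (add_monoid T)" "t \<in> carrier (add_monoid T)"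
    then obtain p q where "p \<in> carrier M" "q \<in> carrier M" "s = J +>\<^bsub>M\<^esub> p" "t = J +>\<^bsub>M\<^esub> q"
      by (auto simp: proj_surj)
    then show "h (s \<otimes>\<^bsub>add_monoid T\<^esub> t) = h s \<otimes>\<^bsub>add_monoid N\<^esub> h t"
      by (simp add: h g.hom_add[simplified] flip: proj_add)
  qed (auto simp: proj_surj h)
  then have "abelian_group_hom T N h"
    by (intro abelian_group_hom.intro abelian_group_hom_axioms.intro group_hom.intro
        group_hom_axioms.intro T.a_group N.a_group T.is_abelian_group N.abelian_group_axioms)
  moreover have "h (x \<otimes>\<^sub>T y) = f x y" if "x \<in> carrier A" "y \<in> carrier B" for x y
    using that by (simp add: pure_tensor_def h g_of)
  ultimately show ?thesis
    by blast
qed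

text \<open>Linearity in both variables implies the balancing condition. Linearity of the induced
  map then has to be checked only on pure tensors, where it is linearity of \<open>f\<close> in its
  left argument.\<close>

lemma tensor_algebra_universal_linear:
  assumes "module K N"
    and closed: "\<And>x y. \<lbrakk>x \<in> carrier A; y \<in> carrier B\<rbrakk> \<Longrightarrow> f x y \<in> carrier N"
    and add_left: "\<And>x x' y. \<lbrakk>x \<in> carrier A; x' \<in> carrier A; y \<in> carrier B\<rbrakk>
      \<Longrightarrow> f (x \<oplus>\<^bsub>A\<^esub> x') y = f x y \<oplus>\<^bsub>N\<^esub> f x' y"
    and add_right: "\<And>x y y'. \<lbrakk>x \<in> carrier A; y \<in> carrier B; y' \<in> carrier B\<rbrakk>
      \<Longrightarrow> f x (y \<oplus>\<^bsub>B\<^esub> y') = f x y \<oplus>\<^bsub>N\<^esub> f x y'"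
    and smult_left: "\<And>c x y. \<lbrakk>c \<in> carrier K; x \<in> carrier A; y \<in> carrier B\<rbrakk>
      \<Longrightarrow> f (c \<odot>\<^bsub>A\<^esub> x) y = c \<odot>\<^bsub>N\<^esub> f x y"
    and smult_right: "\<And>c x y. \<lbrakk>c \<in> carrier K; x \<in> carrier A; y \<in> carrier B\<rbrakk>
      \<Longrightarrow> f x (c \<odot>\<^bsub>B\<^esub> y) = c \<odot>\<^bsub>N\<^esub> f x y"
  shows "\<exists>h. abelian_group_hom T N h \<and> (\<forall>x\<in>carrier A. \<forall>y\<in>carrier B. h (x \<otimes>\<^sub>T y) = f x y) \<and>
    (\<forall>c\<in>carrier K. \<forall>t\<in>carrier T. h (c \<odot>\<^bsub>T\<^esub> t) = c \<odot>\<^bsub>N\<^esub> h t)"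
proof -
  interpret N: module K N by fact
  interpret T: assoc_algebra K T by (rule assoc_algebra_tensor_algebra)
  have "\<exists>h. abelian_group_hom T N h \<and> (\<forall>x\<in>carrier A. \<forall>y\<in>carrier B. h (x \<otimes>\<^sub>T y) = f x y)"
    by (rule tensor_algebra_universal[OF N.abelian_group_axioms, of f])
      (simp_all add: closed add_left add_right smult_left smult_right)
  then obtain h where h: "abelian_group_hom T N h"
    and h_tensor: "\<And>x y. \<lbrakk>x \<in> carrier A; y \<in> carrier B\<rbrakk> \<Longrightarrow> h (x \<otimes>\<^sub>T y) = f x y"
    by blast
  interpret h: abelian_group_hom T N h by (rule h)
  have "h (c \<odot>\<^bsub>T\<^esub> t) = c \<odot>\<^bsub>N\<^esub> h t" if c: "c \<in> carrier K" and t: "t \<in> carrier T" for c t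
    using t
  proof (induction t rule: tensor_algebra_induct)
    case zero
    show ?case
      using c T.smult_r_null N.smult_r_null h.hom_zero by simp
  next
    case (diff s t)
    then show ?case
      using c by (simp add: a_minus_def T.smult_r_distr T.smult_r_minus N.smult_r_distr N.smult_r_minus)
  next
    case (tensor x y)
    then show ?case
      using c by (simp add: smult_tensor h_tensor smult_left)
  qed
  then show ?thesis
    using h h_tensor by blast
qed

end

section \<open>Sandwich operators\<close>

lemma tensor_product_sq: "assoc_algebra K A \<Longrightarrow> tensor_product K A A"
  by (simp add: tensor_product_def)

text \<open>The square is itself an associative algebra over \<open>K\<close>, so it may serve as
  the left factor of a further tensor product.\<close>

lemma tensor_product_cube: "assoc_algebra K A \<Longrightarrow> tensor_product K (tensor_sq K A) A"
  by (simp add: tensor_product_def tensor_sq_def tensor_product.assoc_algebra_tensor_algebra)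

lemma pure2_closed:
  assumes "assoc_algebra K A" "x \<in> carrier A" "y \<in> carrier A"
  shows "pure2 K A x y \<in> carrier (tensor_sq K A)"
  using tensor_product.tensor_closed[OF tensor_product_sq] assms by (simp add: pure2_def tensor_sq_def)

lemma pure3_closed:
  assumes "assoc_algebra K A" "x \<in> carrier A" "y \<in> carrier A" "z \<in> carrier A"
  shows "pure3 K A x y z \<in> carrier (tensor_cube K A)"
  using tensor_product.tensor_closed[OF tensor_product_cube[OF assms(1)], of "pure2 K A x y" z] assms
  by (simp add: pure3_def tensor_cube_def pure2_closed)

lemma pure3_mult:
  assumes "assoc_algebra K A" "x \<in> carrier A" "y \<in> carrier A" "z \<in> carrier A"
    "x' \<in> carrier A" "y' \<in> carrier A" "z' \<in> carrier A"
  shows "pure3 K A x y z \<otimes>\<^bsub>tensor_cube K A\<^esub> pure3 K A x' y' z' =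
    pure3 K A (x \<otimes>\<^bsub>A\<^esub> x') (y \<otimes>\<^bsub>A\<^esub> y') (z \<otimes>\<^bsub>A\<^esub> z')"
  using tensor_product.tensor_mult[OF tensor_product_sq[OF assms(1)], of x x' y y']
    tensor_product.tensor_mult[OF tensor_product_cube[OF assms(1)], of "pure2 K A x y" "pure2 K A x' y'" z z']
    assms
  \<comment> \<open>The outer product is computed first, while the inner tensors are still folded
    and \<open>pure2_closed\<close> applies; only then is the product in the square
    unfolded.\<close>
  by (simp add: pure3_def tensor_cube_def pure2_closed) (simp add: pure2_def tensor_sq_def)

text \<open>With \<open>a\<close> fixed, the product is linear in each outer factor because scalars
  move freely through products.\<close>

lemma sandwich_hom:
  fixes K (structure) and A (structure)
  assumes "assoc_algebra K A" and a: "a \<in> carrier A"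
  obtains h where "abelian_group_hom (tensor_sq K A) A h"
    and "\<And>x y. \<lbrakk>x \<in> carrier A; y \<in> carrier A\<rbrakk> \<Longrightarrow> h (pure2 K A x y) = x \<otimes>\<^bsub>A\<^esub> a \<otimes>\<^bsub>A\<^esub> y"
    and "\<And>c t. \<lbrakk>c \<in> carrier K; t \<in> carrier (tensor_sq K A)\<rbrakk>
      \<Longrightarrow> h (c \<odot>\<^bsub>tensor_sq K A\<^esub> t) = c \<odot>\<^bsub>A\<^esub> h t"
proof -
  interpret A: assoc_algebra K A by fact
  have "\<exists>h. abelian_group_hom (tensor_algebra K A A) A h \<and>
      (\<forall>x\<in>carrier A. \<forall>y\<in>carrier A. h (pure_tensor K A A x y) = x \<otimes>\<^bsub>A\<^esub> a \<otimes>\<^bsub>A\<^esub> y) \<and>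
      (\<forall>c\<in>carrier K. \<forall>t\<in>carrier (tensor_algebra K A A). h (c \<odot>\<^bsub>tensor_algebra K A A\<^esub> t) = c \<odot>\<^bsub>A\<^esub> h t)"
    by (rule tensor_product.tensor_algebra_universal_linear
        [OF tensor_product_sq[OF assms(1)] A.module_axioms, of "\<lambda>x y. x \<otimes>\<^bsub>A\<^esub> a \<otimes>\<^bsub>A\<^esub> y"])
      (use a in \<open>simp_all add: A.l_distr A.r_distr A.smult_mult_left A.smult_mult_right\<close>)
  then show thesis
    using that by (auto simp: pure2_def tensor_sq_def)
qed

text \<open>The construction follows the bracketing of the cube: \<open>g\<close> handles the first
  two factors, and the universal property is applied again to the map taking \<open>t\<close> and
  \<open>z\<close> to g(t) b z. Linearity of \<open>g\<close> over \<open>K\<close> is what makes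
  this second map linear in \<open>t\<close>.\<close>

lemma double_sandwich_hom:
  fixes K (structure) and A (structure)
  assumes "assoc_algebra K A" and a: "a \<in> carrier A" and b: "b \<in> carrier A"
  obtains h where "abelian_group_hom (tensor_cube K A) A h"
    and "\<And>x y z. \<lbrakk>x \<in> carrier A; y \<in> carrier A; z \<in> carrier A\<rbrakk>
      \<Longrightarrow> h (pure3 K A x y z) = x \<otimes>\<^bsub>A\<^esub> a \<otimes>\<^bsub>A\<^esub> y \<otimes>\<^bsub>A\<^esub> b \<otimes>\<^bsub>A\<^esub> z"
    and "\<And>c t. \<lbrakk>c \<in> carrier K; t \<in> carrier (tensor_cube K A)\<rbrakk>
      \<Longrightarrow> h (c \<odot>\<^bsub>tensor_cube K A\<^esub> t) = c \<odot>\<^bsub>A\<^esub> h t"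
proof -
  interpret A: assoc_algebra K A by fact
  obtain g where "abelian_group_hom (tensor_sq K A) A g"
    and g_pure: "\<And>x y. \<lbrakk>x \<in> carrier A; y \<in> carrier A\<rbrakk> \<Longrightarrow> g (pure2 K A x y) = x \<otimes>\<^bsub>A\<^esub> a \<otimes>\<^bsub>A\<^esub> y"
    and g_smult: "\<And>c t. \<lbrakk>c \<in> carrier K; t \<in> carrier (tensor_sq K A)\<rbrakk>
      \<Longrightarrow> g (c \<odot>\<^bsub>tensor_sq K A\<^esub> t) = c \<odot>\<^bsub>A\<^esub> g t"
    using sandwich_hom[OF assms(1) a] by blast
  then interpret g: abelian_group_hom "tensor_sq K A" A g by simp
  have "\<exists>h. abelian_group_hom (tensor_cube K A) A h \<and>
      (\<forall>t\<in>carrier (tensor_sq K A). \<forall>z\<in>carrier A.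
        h (pure_tensor K (tensor_sq K A) A t z) = g t \<otimes>\<^bsub>A\<^esub> b \<otimes>\<^bsub>A\<^esub> z) \<and>
      (\<forall>c\<in>carrier K. \<forall>t\<in>carrier (tensor_cube K A). h (c \<odot>\<^bsub>tensor_cube K A\<^esub> t) = c \<odot>\<^bsub>A\<^esub> h t)"
    unfolding tensor_cube_def
    by (rule tensor_product.tensor_algebra_universal_linear
        [OF tensor_product_cube[OF assms(1)] A.module_axioms, of "\<lambda>t z. g t \<otimes>\<^bsub>A\<^esub> b \<otimes>\<^bsub>A\<^esub> z"])
      (use b in \<open>simp_all add: A.l_distr A.r_distr A.smult_mult_left A.smult_mult_right g_smult\<close>)
  then obtain h where "abelian_group_hom (tensor_cube K A) A h"
    and "\<And>t z. \<lbrakk>t \<in> carrier (tensor_sq K A); z \<in> carrier A\<rbrakk>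
      \<Longrightarrow> h (pure_tensor K (tensor_sq K A) A t z) = g t \<otimes>\<^bsub>A\<^esub> b \<otimes>\<^bsub>A\<^esub> z"
    and "\<And>c t. \<lbrakk>c \<in> carrier K; t \<in> carrier (tensor_cube K A)\<rbrakk>
      \<Longrightarrow> h (c \<odot>\<^bsub>tensor_cube K A\<^esub> t) = c \<odot>\<^bsub>A\<^esub> h t"
    by blast
  then show thesis
    using that[of h] assms(1) by (simp add: pure3_def pure2_closed g_pure)
qed

lemma hom_tensor_sum:
  assumes "assoc_algebra K A" "a \<in> carrier A" "abelian_group_hom (tensor_sq K A) A h"
    and h_pure: "\<And>x y. \<lbrakk>x \<in> carrier A; y \<in> carrier A\<rbrakk> \<Longrightarrow> h (pure2 K A x y) = x \<otimes>\<^bsub>A\<^esub> a \<otimes>\<^bsub>A\<^esub> y"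
    and uv: "u \<in> I \<rightarrow> carrier A" "v \<in> I \<rightarrow> carrier A"
  shows "h (tensor_sum K A I u v) = sandwich_operator A I u v a"
proof -
  interpret A: assoc_algebra K A by fact
  interpret h: abelian_group_hom "tensor_sq K A" A h by fact
  have "h (tensor_sum K A I u v) = (\<Oplus>\<^bsub>A\<^esub>i\<in>I. h (pure2 K A (u i) (v i)))"
    unfolding tensor_sum_def using uv
    by (intro h.hom_finsum funcsetI pure2_closed[OF assms(1)]) auto
  also have "\<dots> = sandwich_operator A I u v a"
    unfolding sandwich_operator_def using uv assms(2)
    by (intro A.finsum_cong') (simp_all add: h_pure Pi_iff)
  finally show ?thesis .
qed

text \<open>Both sides are the value of one homomorphism at one tensor. This matters because the
  expression witnessing the Yang-Baxter equation may differ from the expression defining the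
  operator.\<close>

lemma sandwich_operator_cong:
  assumes "assoc_algebra K A" "a \<in> carrier A"
    and "u \<in> I \<rightarrow> carrier A" "v \<in> I \<rightarrow> carrier A" "u' \<in> J \<rightarrow> carrier A" "v' \<in> J \<rightarrow> carrier A"
    and eq: "tensor_sum K A I u v = tensor_sum K A J u' v'"
  shows "sandwich_operator A I u v a = sandwich_operator A J u' v' a"
proof -
  obtain h where h: "abelian_group_hom (tensor_sq K A) A h"
    and h_pure: "\<And>x y. \<lbrakk>x \<in> carrier A; y \<in> carrier A\<rbrakk> \<Longrightarrow> h (pure2 K A x y) = x \<otimes>\<^bsub>A\<^esub> a \<otimes>\<^bsub>A\<^esub> y"
    and "\<And>c t. \<lbrakk>c \<in> carrier K; t \<in> carrier (tensor_sq K A)\<rbrakk>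
      \<Longrightarrow> h (c \<odot>\<^bsub>tensor_sq K A\<^esub> t) = c \<odot>\<^bsub>A\<^esub> h t"
    using sandwich_hom[OF assms(1,2)] by blast
  have "h (tensor_sum K A I u v) = sandwich_operator A I u v a"
    by (rule hom_tensor_sum[OF assms(1,2) h]) (simp_all add: h_pure assms(3,4))
  moreover have "h (tensor_sum K A J u' v') = sandwich_operator A J u' v' a"
    by (rule hom_tensor_sum[OF assms(1,2) h]) (simp_all add: h_pure assms(5,6))
  ultimately show ?thesis
    using eq by simp
qed

lemma sandwich_operator_closed:
  assumes "assoc_algebra K A" "u \<in> I \<rightarrow> carrier A" "v \<in> I \<rightarrow> carrier A" "a \<in> carrier A"
  shows "sandwich_operator A I u v a \<in> carrier A"
proof -
  interpret A: assoc_algebra K A by fact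
  show ?thesis
    unfolding sandwich_operator_def using assms(2-4) by (intro A.finsum_closed) (simp add: Pi_iff)
qed

lemma linear_operator_sandwich_operator:
  assumes "assoc_algebra K A" "finite I" and uv: "u \<in> I \<rightarrow> carrier A" "v \<in> I \<rightarrow> carrier A"
  shows "linear_operator K A (sandwich_operator A I u v)"
proof -
  interpret A: assoc_algebra K A by fact
  have u: "u i \<in> carrier A" and v: "v i \<in> carrier A" if "i \<in> I" for i
    using that uv by auto
  show ?thesis
    unfolding linear_operator_def
  proof (intro conjI ballI funcsetI)
    fix a b assume a: "a \<in> carrier A" and b: "b \<in> carrier A"
    have "sandwich_operator A I u v (a \<oplus>\<^bsub>A\<^esub> b) =
        (\<Oplus>\<^bsub>A\<^esub>i\<in>I. u i \<otimes>\<^bsub>A\<^esub> a \<otimes>\<^bsub>A\<^esub> v i \<oplus>\<^bsub>A\<^esub> u i \<otimes>\<^bsub>A\<^esub> b \<otimes>\<^bsub>A\<^esub> v i)"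
      unfolding sandwich_operator_def
      by (rule A.finsum_cong') (simp_all add: a b u v A.l_distr A.r_distr)
    also have "\<dots> = sandwich_operator A I u v a \<oplus>\<^bsub>A\<^esub> sandwich_operator A I u v b"
      unfolding sandwich_operator_def by (rule A.finsum_addf) (simp_all add: a b u v)
    finally show "sandwich_operator A I u v (a \<oplus>\<^bsub>A\<^esub> b) =
        sandwich_operator A I u v a \<oplus>\<^bsub>A\<^esub> sandwich_operator A I u v b" .
  next
    fix c a assume c: "c \<in> carrier K" and a: "a \<in> carrier A"
    have "sandwich_operator A I u v (c \<odot>\<^bsub>A\<^esub> a) = (\<Oplus>\<^bsub>A\<^esub>i\<in>I. c \<odot>\<^bsub>A\<^esub> (u i \<otimes>\<^bsub>A\<^esub> a \<otimes>\<^bsub>A\<^esub> v i))"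
      unfolding sandwich_operator_def
      by (rule A.finsum_cong') (simp_all add: a c u v A.smult_mult_left A.smult_mult_right)
    also have "\<dots> = c \<odot>\<^bsub>A\<^esub> sandwich_operator A I u v a"
      unfolding sandwich_operator_def
      by (rule A.finsum_smult_ldistr[symmetric]) (simp_all add: assms(2) a c u v)
    finally show "sandwich_operator A I u v (c \<odot>\<^bsub>A\<^esub> a) = c \<odot>\<^bsub>A\<^esub> sandwich_operator A I u v a" .
  qed (rule sandwich_operator_closed[OF assms(1) uv])
qed

section \<open>Double sums and the Rota-Baxter identity\<close>

context ring
begin

lemma finsum_mult_finsum:
  assumes "finite I" "finite J" "f \<in> I \<rightarrow> carrier R" "g \<in> J \<rightarrow> carrier R"
  shows "(\<Oplus>i\<in>I. f i) \<otimes> (\<Oplus>j\<in>J. g j) = (\<Oplus>i\<in>I. \<Oplus>j\<in>J. f i \<otimes> g j)"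
proof -
  have "(\<Oplus>i\<in>I. f i) \<otimes> (\<Oplus>j\<in>J. g j) = (\<Oplus>i\<in>I. f i \<otimes> (\<Oplus>j\<in>J. g j))"
    by (rule finsum_ldistr) (use assms in auto)
  also have "\<dots> = (\<Oplus>i\<in>I. \<Oplus>j\<in>J. f i \<otimes> g j)"
    by (rule finsum_cong') (use assms in \<open>auto intro!: finsum_rdistr finsum_closed simp: Pi_iff\<close>)
  finally show ?thesis .
qed

text \<open>Taking the index of the second factor as the outer one avoids a later exchange of sums
  when the second factor supplies the outer layer, as in P(a P(b)).\<close>

lemma finsum_mult_finsum':
  assumes "finite I" "finite J" "f \<in> I \<rightarrow> carrier R" "g \<in> J \<rightarrow> carrier R"
  shows "(\<Oplus>i\<in>I. f i) \<otimes> (\<Oplus>j\<in>J. g j) = (\<Oplus>j\<in>J. \<Oplus>i\<in>I. f i \<otimes> g j)"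
proof -
  have "(\<Oplus>i\<in>I. f i) \<otimes> (\<Oplus>j\<in>J. g j) = (\<Oplus>j\<in>J. (\<Oplus>i\<in>I. f i) \<otimes> g j)"
    by (rule finsum_rdistr) (use assms in auto)
  also have "\<dots> = (\<Oplus>j\<in>J. \<Oplus>i\<in>I. f i \<otimes> g j)"
    by (rule finsum_cong') (use assms in \<open>auto intro!: finsum_ldistr finsum_closed simp: Pi_iff\<close>)
  finally show ?thesis .
qed

end

text \<open>The image summand \<open>g\<close> is a separate parameter, so the target may be stated
  in whatever bracketing the next step requires.\<close>

lemma (in abelian_group_hom) hom_finsum_finsum:
  assumes "\<And>i j. \<lbrakk>i \<in> I; j \<in> J\<rbrakk> \<Longrightarrow> f i j \<in> carrier G"
    and "\<And>i j. \<lbrakk>i \<in> I; j \<in> J\<rbrakk> \<Longrightarrow> h (f i j) = g i j"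
  shows "h (\<Oplus>\<^bsub>G\<^esub>i\<in>I. \<Oplus>\<^bsub>G\<^esub>j\<in>J. f i j) = (\<Oplus>\<^bsub>H\<^esub>i\<in>I. \<Oplus>\<^bsub>H\<^esub>j\<in>J. g i j)"
proof -
  have g: "g i j \<in> carrier H" if "i \<in> I" "j \<in> J" for i j
    using assms(1)[OF that] assms(2)[OF that] hom_closed by metis
  have "h (\<Oplus>\<^bsub>G\<^esub>i\<in>I. \<Oplus>\<^bsub>G\<^esub>j\<in>J. f i j) = (\<Oplus>\<^bsub>H\<^esub>i\<in>I. h (\<Oplus>\<^bsub>G\<^esub>j\<in>J. f i j))"
    by (rule hom_finsum) (simp add: Pi_iff assms(1))
  also have "\<dots> = (\<Oplus>\<^bsub>H\<^esub>i\<in>I. \<Oplus>\<^bsub>H\<^esub>j\<in>J. g i j)"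
  proof (rule H.finsum_cong')
    fix i assume i: "i \<in> I"
    have "h (\<Oplus>\<^bsub>G\<^esub>j\<in>J. f i j) = (\<Oplus>\<^bsub>H\<^esub>j\<in>J. h (f i j))"
      by (rule hom_finsum) (simp add: Pi_iff assms(1) i)
    also have "\<dots> = (\<Oplus>\<^bsub>H\<^esub>j\<in>J. g i j)"
      by (rule H.finsum_cong') (simp_all add: assms i g)
    finally show "h (\<Oplus>\<^bsub>G\<^esub>j\<in>J. f i j) = (\<Oplus>\<^bsub>H\<^esub>j\<in>J. g i j)" .
  qed (simp_all add: g)
  finally show ?thesis .
qed

text \<open>Here the Yang-Baxter equation is assumed for the very expression that defines
  \<open>P\<close>; \<open>sandwich_operator_cong\<close> later lifts this restriction.\<close>

lemma rota_baxter_sandwich_operator: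
  fixes K (structure) and A (structure) and u v :: "'i \<Rightarrow> 'a"
  assumes "assoc_algebra K A" "lam \<in> carrier K" "finite I"
    and uv: "u \<in> I \<rightarrow> carrier A" "v \<in> I \<rightarrow> carrier A"
    and aybe: "leg13 K A I u v \<otimes>\<^bsub>tensor_cube K A\<^esub> leg12 K A I u v
        \<ominus>\<^bsub>tensor_cube K A\<^esub> leg12 K A I u v \<otimes>\<^bsub>tensor_cube K A\<^esub> leg23 K A I u v
        \<oplus>\<^bsub>tensor_cube K A\<^esub> leg23 K A I u v \<otimes>\<^bsub>tensor_cube K A\<^esub> leg13 K A I u v
      = lam \<odot>\<^bsub>tensor_cube K A\<^esub> leg13 K A I u v"
    and a: "a \<in> carrier A" and b: "b \<in> carrier A"
  defines "P \<equiv> sandwich_operator A I u v"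
  shows "P a \<otimes>\<^bsub>A\<^esub> P b = P (a \<otimes>\<^bsub>A\<^esub> P b) \<oplus>\<^bsub>A\<^esub> P (P a \<otimes>\<^bsub>A\<^esub> b) \<oplus>\<^bsub>A\<^esub> (\<ominus>\<^bsub>K\<^esub> lam) \<odot>\<^bsub>A\<^esub> P (a \<otimes>\<^bsub>A\<^esub> b)"
proof -
  interpret A: assoc_algebra K A by fact
  let ?C = "tensor_cube K A"
  interpret C: ring ?C
    using tensor_product.assoc_algebra_tensor_algebra[OF tensor_product_cube[OF assms(1)]]
    by (simp add: tensor_cube_def assoc_algebra_def)
  have u: "u i \<in> carrier A" and v: "v i \<in> carrier A" if "i \<in> I" for i
    using that uv by auto
  have P: "P x \<in> carrier A" if "x \<in> carrier A" for x
    unfolding P_def using that by (rule sandwich_operator_closed[OF assms(1) uv])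
  obtain h where "abelian_group_hom ?C A h"
    and h_pure: "\<And>x y z. \<lbrakk>x \<in> carrier A; y \<in> carrier A; z \<in> carrier A\<rbrakk>
      \<Longrightarrow> h (pure3 K A x y z) = x \<otimes>\<^bsub>A\<^esub> a \<otimes>\<^bsub>A\<^esub> y \<otimes>\<^bsub>A\<^esub> b \<otimes>\<^bsub>A\<^esub> z"
    and h_smult: "\<And>c t. \<lbrakk>c \<in> carrier K; t \<in> carrier ?C\<rbrakk> \<Longrightarrow> h (c \<odot>\<^bsub>?C\<^esub> t) = c \<odot>\<^bsub>A\<^esub> h t"
    using double_sandwich_hom[OF assms(1) a b] by blast
  then interpret h: abelian_group_hom ?C A h by simp
  note pure3 = pure3_closed[OF assms(1)] pure3_mult[OF assms(1)]
  have legs: "leg12 K A I u v \<in> carrier ?C" "leg13 K A I u v \<in> carrier ?C" "leg23 K A I u v \<in> carrier ?C"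
    unfolding leg12_def leg13_def leg23_def
    by (intro C.finsum_closed funcsetI pure3(1) u v A.one_closed; assumption)+

  \<comment> \<open>The summands of the product are u_i u_j \<otimes> v_j \<otimes> v_i, so the
    terms indexed by j nest inside those indexed by i and sum to P(a).\<close>
  have "h (leg13 K A I u v \<otimes>\<^bsub>?C\<^esub> leg12 K A I u v) =
      (\<Oplus>\<^bsub>A\<^esub>i\<in>I. \<Oplus>\<^bsub>A\<^esub>j\<in>I. u i \<otimes>\<^bsub>A\<^esub> (u j \<otimes>\<^bsub>A\<^esub> a \<otimes>\<^bsub>A\<^esub> v j \<otimes>\<^bsub>A\<^esub> b) \<otimes>\<^bsub>A\<^esub> v i)"
    unfolding leg13_def leg12_def
    by (subst C.finsum_mult_finsum; (rule h.hom_finsum_finsum)?;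
      simp add: assms(3) u v pure3 h_pure a b A.m_assoc)
  also have "\<dots> = (\<Oplus>\<^bsub>A\<^esub>i\<in>I. u i \<otimes>\<^bsub>A\<^esub> (P a \<otimes>\<^bsub>A\<^esub> b) \<otimes>\<^bsub>A\<^esub> v i)"
    unfolding P_def sandwich_operator_def
    by (rule A.finsum_cong')
      (simp_all add: assms(3) u v a b Pi_iff A.finsum_ldistr A.finsum_rdistr)
  finally have eq1: "h (leg13 K A I u v \<otimes>\<^bsub>?C\<^esub> leg12 K A I u v) = P (P a \<otimes>\<^bsub>A\<^esub> b)"
    by (simp add: P_def sandwich_operator_def)

  \<comment> \<open>Here the summands are u_j \<otimes> u_i \<otimes> v_i v_j: the second factor
    encloses the first, hence the variant with j outermost.\<close>
  have "h (leg23 K A I u v \<otimes>\<^bsub>?C\<^esub> leg13 K A I u v) =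
      (\<Oplus>\<^bsub>A\<^esub>j\<in>I. \<Oplus>\<^bsub>A\<^esub>i\<in>I. u j \<otimes>\<^bsub>A\<^esub> (a \<otimes>\<^bsub>A\<^esub> (u i \<otimes>\<^bsub>A\<^esub> b \<otimes>\<^bsub>A\<^esub> v i)) \<otimes>\<^bsub>A\<^esub> v j)"
    unfolding leg23_def leg13_def
    by (subst C.finsum_mult_finsum'; (rule h.hom_finsum_finsum)?;
      simp add: assms(3) u v pure3 h_pure a b A.m_assoc)
  also have "\<dots> = (\<Oplus>\<^bsub>A\<^esub>j\<in>I. u j \<otimes>\<^bsub>A\<^esub> (a \<otimes>\<^bsub>A\<^esub> P b) \<otimes>\<^bsub>A\<^esub> v j)"
    unfolding P_def sandwich_operator_def
    by (rule A.finsum_cong')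
      (simp_all add: assms(3) u v a b Pi_iff A.finsum_ldistr A.finsum_rdistr)
  finally have eq2: "h (leg23 K A I u v \<otimes>\<^bsub>?C\<^esub> leg13 K A I u v) = P (a \<otimes>\<^bsub>A\<^esub> P b)"
    by (simp add: P_def sandwich_operator_def)

  \<comment> \<open>The summands u_i \<otimes> v_i u_j \<otimes> v_j do not nest but stand side by
    side, so the double sum splits into a product.\<close>
  have "h (leg12 K A I u v \<otimes>\<^bsub>?C\<^esub> leg23 K A I u v) =
      (\<Oplus>\<^bsub>A\<^esub>i\<in>I. \<Oplus>\<^bsub>A\<^esub>j\<in>I. (u i \<otimes>\<^bsub>A\<^esub> a \<otimes>\<^bsub>A\<^esub> v i) \<otimes>\<^bsub>A\<^esub> (u j \<otimes>\<^bsub>A\<^esub> b \<otimes>\<^bsub>A\<^esub> v j))"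
    unfolding leg12_def leg23_def
    by (subst C.finsum_mult_finsum; (rule h.hom_finsum_finsum)?;
      simp add: assms(3) u v pure3 h_pure a b A.m_assoc)
  also have "\<dots> = P a \<otimes>\<^bsub>A\<^esub> P b"
    unfolding P_def sandwich_operator_def
    by (rule A.finsum_mult_finsum[symmetric]) (simp_all add: assms(3) u v a b)
  finally have eq3: "h (leg12 K A I u v \<otimes>\<^bsub>?C\<^esub> leg23 K A I u v) = P a \<otimes>\<^bsub>A\<^esub> P b" .

  have "h (leg13 K A I u v) = (\<Oplus>\<^bsub>A\<^esub>i\<in>I. h (pure3 K A (u i) \<one>\<^bsub>A\<^esub> (v i)))"
    unfolding leg13_def by (rule h.hom_finsum) (simp add: Pi_iff pure3 u v)
  also have "\<dots> = P (a \<otimes>\<^bsub>A\<^esub> b)"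
    unfolding P_def sandwich_operator_def
    by (rule A.finsum_cong') (simp_all add: u v a b h_pure A.m_assoc)
  finally have eq4: "h (leg13 K A I u v) = P (a \<otimes>\<^bsub>A\<^esub> b)" .

  \<comment> \<open>This is the image of the Yang-Baxter equation under \<open>h\<close>; membership
    of the legs in the cube lets \<open>h\<close> pass through differences, sums and the
    scalar.\<close>
  have "P (P a \<otimes>\<^bsub>A\<^esub> b) \<ominus>\<^bsub>A\<^esub> P a \<otimes>\<^bsub>A\<^esub> P b \<oplus>\<^bsub>A\<^esub> P (a \<otimes>\<^bsub>A\<^esub> P b) = lam \<odot>\<^bsub>A\<^esub> P (a \<otimes>\<^bsub>A\<^esub> b)"
    using arg_cong[OF aybe, of h] legs assms(2)
    by (simp add: h_smult eq1 eq2 eq3 eq4)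
  \<comment> \<open>Solves the image equation for z = P(a) P(b), with x = P(P(a) b) and y = P(a
    P(b)). Negating the bracket is what turns the weight \<open>lam\<close> into its
    negative.\<close>
  moreover have "z = y \<oplus>\<^bsub>A\<^esub> x \<oplus>\<^bsub>A\<^esub> \<ominus>\<^bsub>A\<^esub> (x \<ominus>\<^bsub>A\<^esub> z \<oplus>\<^bsub>A\<^esub> y)"
    if "x \<in> carrier A" "y \<in> carrier A" "z \<in> carrier A" for x y z
    using that by algebra
  ultimately show ?thesis
    using assms(2) a b P A.smult_l_minus[of lam "P (a \<otimes>\<^bsub>A\<^esub> b)"] by (metis A.m_closed)
qed

theorem theorem4p10:
  fixes K :: "('k, 'r) ring_scheme"
    and A :: "('k, 'a, 'm) module_scheme"
    and lam :: 'k
    and I :: "'i set"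
    and u v :: "'i \<Rightarrow> 'a"
    and r :: "('a \<times> 'a \<Rightarrow>\<^sub>0 int) set"
  assumes "assoc_algebra K A"
    and "lam \<in> carrier K"
    and "finite I"
    and "u \<in> I \<rightarrow> carrier A"
    and "v \<in> I \<rightarrow> carrier A"
    and "r = tensor_sum K A I u v"
    and "aybe_solution K A lam r"
  shows "rota_baxter_operator K A (\<ominus>\<^bsub>K\<^esub> lam) (sandwich_operator A I u v)"
proof -
  interpret A: assoc_algebra K A by fact
  let ?P = "sandwich_operator A I u v"
  \<comment> \<open>The equation comes with its own expression of \<open>r\<close>, unrelated to
    \<open>u\<close> and \<open>v\<close> except that both represent the same tensor.\<close>
  obtain n :: nat and u' v' where uv': "u' \<in> {..<n} \<rightarrow> carrier A" "v' \<in> {..<n} \<rightarrow> carrier A"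
    and r: "r = tensor_sum K A {..<n} u' v'"
    and aybe: "leg13 K A {..<n} u' v' \<otimes>\<^bsub>tensor_cube K A\<^esub> leg12 K A {..<n} u' v'
        \<ominus>\<^bsub>tensor_cube K A\<^esub> leg12 K A {..<n} u' v' \<otimes>\<^bsub>tensor_cube K A\<^esub> leg23 K A {..<n} u' v'
        \<oplus>\<^bsub>tensor_cube K A\<^esub> leg23 K A {..<n} u' v' \<otimes>\<^bsub>tensor_cube K A\<^esub> leg13 K A {..<n} u' v'
      = lam \<odot>\<^bsub>tensor_cube K A\<^esub> leg13 K A {..<n} u' v'"
    using assms(7) unfolding aybe_solution_def Let_def by blast
  let ?P' = "sandwich_operator A {..<n} u' v'"
  have eq: "?P a = ?P' a" if "a \<in> carrier A" for a
    using sandwich_operator_cong[OF assms(1) that assms(4,5) uv'] assms(6) r by simp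
  \<comment> \<open>The operators are known to agree only on the carrier, so rewriting nested
    occurrences such as P(a P(b)) requires their arguments to be in the carrier.\<close>
  have closed: "?P a \<in> carrier A" if "a \<in> carrier A" for a
    using that by (rule sandwich_operator_closed[OF assms(1,4,5)])
  have "?P a \<otimes>\<^bsub>A\<^esub> ?P b =
      ?P (a \<otimes>\<^bsub>A\<^esub> ?P b) \<oplus>\<^bsub>A\<^esub> ?P (?P a \<otimes>\<^bsub>A\<^esub> b) \<oplus>\<^bsub>A\<^esub> (\<ominus>\<^bsub>K\<^esub> lam) \<odot>\<^bsub>A\<^esub> ?P (a \<otimes>\<^bsub>A\<^esub> b)"
    if "a \<in> carrier A" "b \<in> carrier A" for a b
    using rota_baxter_sandwich_operator[OF assms(1,2) finite_lessThan uv' aybe that] that closed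
    by (simp flip: eq)
  then show ?thesis
    using linear_operator_sandwich_operator[OF assms(1,3-5)] by (simp add: rota_baxter_operator_def)
qed

end
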